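(* Let $K$ be a field and let $E=(E^0,E^1,r,s)$ be a countable graph. Let $X\subseteq\mathbb{R}$, $\{R_e\}_{e\in E^1}$, $\{D_v\}_{v\in E^0}$ and $\{f_e\}_{e\in E^1}$ be the $E$-algebraic branching system constructed in the context, where $X$ is a (possibly unbounded) interval of $\mathbb{R}$, and let $M$ be the $K$-module of all functions $X\to K$. Then there exists a $K$-algebra homomorphism $\pi:L_K(E)\to\mathrm{Hom}_K(M)$ such that $$\pi(v)(\phi)=\chi_{D_v}\cdot\phi,\qquad \pi(e)(\phi)=\chi_{R_e}\cdot\phi\circ f_e^{-1},\qquad \pi(e^* )(\phi)=\chi_{D_{r(e)}}\cdot\phi\circ f_e$$ for all $\phi\in M$, $v\in E^0$, $e\in E^1$.
   Context: A graph $E=(E^0,E^1,r,s)$ is a directed graph with vertex set $E^0$, edge set $E^1$ (both countable) and range and source maps $r,s:E^1\to E^0$. A sink is a vertex $v\notin s(E^1)$. The Leavitt path algebra $L_K(E)$ is the universal $K$-algebra (not necessarily unital) generated by a set $\{v:v\in E^0\}$ of pairwise orthogonal idempotents together with elements $\{e,e^*:e\in E^1\}$ satisfying: (1) $s(e)e=er(e)=e$ for all $e\in E^1$; (2) $r(e)e^*=e^*s(e)=e^*$ for all $e\in E^1$; (3) $e^*f=\delta_{e,f}r(e)$ for all $e,f\in E^1$; (4) $v=\sum_{e:s(e)=v}ee^*$ for every vertex $v$ with $0<\#\{e:s(e)=v\}<\infty$. An $E$-algebraic branching system consists of a set $X$, subsets $R_e$ ($e\in E^1$) and $D_v$ ($v\in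 E^0$) of $X$, and maps $f_e$ such that: the $R_e$ are pairwise disjoint; the $D_v$ are pairwise disjoint; $R_e\subseteq D_{s(e)}$; $D_v=\bigcup_{e:s(e)=v}R_e$ if $0<\#\{e:s(e)=v\}<\infty$; and each $f_e:D_{r(e)}\to R_e$ is a bijection. Construction of the system. Enumerate $E^1=\{e_1,e_2,\dots\}$ (finite or infinite) and the set of sinks $W=\{v_1,v_2,\dots\}$ (finite or infinite), without repetition. Put $R_{e_i}=[i-1,i)$; $D_{v_i}=[-i,-i+1)$ for $v_i\in W$; and $D_u=\bigcup_{e:s(e)=u}R_e$ for $u\in E^0$ not a sink. For $e\in E^1$ with $r(e)$ a sink, let $f_e:D_{r(e)}\to R_e$ be any bijection (for example the linear one). For $e\in E^1$ with $r(e)$ not a sink, partition $R_e$ into pairwise disjoint intervals $I_d$, closed on the left and open on the right, indexed by the edges $d$ with $s(d)=r(e)$, and let $f_e:D_{r(e)}\to R_e$ be a map restricting to a bijection $R_d\to I_d$ (for example the linear one) for each such $d$. Put $X=\left(\bigcup_{e\in E^1}R_e\right)\cup\left(\bigcup_{v\in W}D_v\right)$. Notation: $\chi_{R_e}\cdot\phi\circ f_e^{-1}$ denotes the function equal to $\phi(f_e^{-1}(x))$ for $x\in R_e$ and $0$ otherwise; $\chi_{D_{r(e)}}\cdot\phi\circ f_e$ denotes the function equal to $\phi(f_e(x))$ for $x\in D_{r(e)}$ and $0$ otherwise; $\chi_{D_v}$ is the characteristic function of $D_v$. $\mathrm{Hom}_K(M)$ is the $K$-algebra of $K$-linear maps $M\to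 M$ under composition. *)

theory Defs
  imports "HOL-Analysis.Analysis" "HOL-Library.Poly_Mapping" "Graph_Theory.Digraph"
begin

section \<open>Algebras over a field, not necessarily unital\<close>

record ('k, 'a) nonunital_algebra =
  acarrier :: "'a set"
  azero :: 'a
  aadd :: "'a \<Rightarrow> 'a \<Rightarrow> 'a"
  amult :: "'a \<Rightarrow> 'a \<Rightarrow> 'a"
  ascale :: "'k \<Rightarrow> 'a \<Rightarrow> 'a"

locale nonunital_algebra =
  fixes A :: "('k::field, 'a) nonunital_algebra"
  assumes zero_closed: "azero A \<in> acarrier A"
    and add_closed: "\<lbrakk>x \<in> acarrier A; y \<in> acarrier A\<rbrakk> \<Longrightarrow> aadd A x y \<in> acarrier A"
    and mult_closed: "\<lbrakk>x \<in> acarrier A; y \<in> acarrier A\<rbrakk> \<Longrightarrow> amult A x y \<in> acarrier A"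
    and scale_closed: "x \<in> acarrier A \<Longrightarrow> ascale A c x \<in> acarrier A"
    and add_assoc: "\<lbrakk>x \<in> acarrier A; y \<in> acarrier A; z \<in> acarrier A\<rbrakk>
          \<Longrightarrow> aadd A (aadd A x y) z = aadd A x (aadd A y z)"
    and add_commute: "\<lbrakk>x \<in> acarrier A; y \<in> acarrier A\<rbrakk> \<Longrightarrow> aadd A x y = aadd A y x"
    and add_zero: "x \<in> acarrier A \<Longrightarrow> aadd A x (azero A) = x"
    and add_inverse: "x \<in> acarrier A \<Longrightarrow> aadd A x (ascale A (- 1) x) = azero A"
    and mult_assoc: "\<lbrakk>x \<in> acarrier A; y \<in> acarrier A; z \<in> acarrier A\<rbrakk>
          \<Longrightarrow> amult A (amult A x y) z = amult A x (amult A y z)"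
    and mult_add_left: "\<lbrakk>x \<in> acarrier A; y \<in> acarrier A; z \<in> acarrier A\<rbrakk>
          \<Longrightarrow> amult A x (aadd A y z) = aadd A (amult A x y) (amult A x z)"
    and mult_add_right: "\<lbrakk>x \<in> acarrier A; y \<in> acarrier A; z \<in> acarrier A\<rbrakk>
          \<Longrightarrow> amult A (aadd A x y) z = aadd A (amult A x z) (amult A y z)"
    and scale_add_right: "\<lbrakk>x \<in> acarrier A; y \<in> acarrier A\<rbrakk>
          \<Longrightarrow> ascale A c (aadd A x y) = aadd A (ascale A c x) (ascale A c y)"
    and scale_add_left: "x \<in> acarrier A
          \<Longrightarrow> ascale A (c + d) x = aadd A (ascale A c x) (ascale A d x)"
    and scale_scale: "x \<in> acarrier A \<Longrightarrow> ascale A c (ascale A d x) = ascale A (c * d) x"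
    and scale_one: "x \<in> acarrier A \<Longrightarrow> ascale A 1 x = x"
    and scale_mult_left: "\<lbrakk>x \<in> acarrier A; y \<in> acarrier A\<rbrakk>
          \<Longrightarrow> amult A (ascale A c x) y = ascale A c (amult A x y)"
    and scale_mult_right: "\<lbrakk>x \<in> acarrier A; y \<in> acarrier A\<rbrakk>
          \<Longrightarrow> amult A x (ascale A c y) = ascale A c (amult A x y)"

definition algebra_hom ::
  "('k, 'a) nonunital_algebra \<Rightarrow> ('k, 'b) nonunital_algebra \<Rightarrow> ('a \<Rightarrow> 'b) set" where
  "algebra_hom A B = {h. h \<in> acarrier A \<rightarrow> acarrier B
     \<and> (\<forall>x\<in>acarrier A. \<forall>y\<in>acarrier A. h (aadd A x y) = aadd B (h x) (h y))
     \<and> (\<forall>x\<in>acarrier A. \<forall>y\<in>acarrier A. h (amult A x y) = amult B (h x) (h y))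
     \<and> (\<forall>c. \<forall>x\<in>acarrier A. h (ascale A c x) = ascale B c (h x))}"


section \<open>The Leavitt path algebra\<close>

text \<open>The free monoid on \<open>'g\<close>, written additively, so that \<open>'g monomial \<Rightarrow>\<^sub>0 'k\<close> with the
  convolution product of \<^theory>\<open>HOL-Library.Poly_Mapping\<close> is the free unital associative algebra.\<close>

datatype 'g monomial = Monomial (letters: "'g list")

instantiation monomial :: (type) monoid_add
begin

definition "0 = Monomial []"
definition "m + n = Monomial (letters m @ letters n)"

instance
  by standard (simp_all add: zero_monomial_def plus_monomial_def)

end

type_synonym ('g, 'k) free_algebra = "'g monomial \<Rightarrow>\<^sub>0 'k"

text \<open>The free algebra without unit on \<open>G\<close>: no constant term.\<close>

definition free_nonunital :: "'g set \<Rightarrow> ('g, 'k::field) free_algebra set" where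
  "free_nonunital G = {p. \<forall>m \<in> Poly_Mapping.keys p. m \<noteq> 0 \<and> set (letters m) \<subseteq> G}"

definition generator :: "'g \<Rightarrow> ('g, 'k::field) free_algebra" where
  "generator g = Poly_Mapping.single (Monomial [g]) 1"

definition scalar_mult :: "'k::field \<Rightarrow> ('g, 'k) free_algebra \<Rightarrow> ('g, 'k) free_algebra" where
  "scalar_mult c p = Poly_Mapping.single 0 c * p"

text \<open>The two-sided algebra ideal of \<open>A\<close> generated by \<open>S\<close>. As \<open>A\<close> has no unit, closure under
  scalars does not follow from closure under multiplication.\<close>

inductive_set generated_ideal ::
    "('g, 'k::field) free_algebra set \<Rightarrow> ('g, 'k) free_algebra set \<Rightarrow> ('g, 'k) free_algebra set"
  for A S where
  zero: "0 \<in> generated_ideal A S"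
| base: "x \<in> S \<Longrightarrow> x \<in> generated_ideal A S"
| add: "\<lbrakk>x \<in> generated_ideal A S; y \<in> generated_ideal A S\<rbrakk> \<Longrightarrow> x + y \<in> generated_ideal A S"
| scale: "x \<in> generated_ideal A S \<Longrightarrow> scalar_mult c x \<in> generated_ideal A S"
| left: "\<lbrakk>a \<in> A; x \<in> generated_ideal A S\<rbrakk> \<Longrightarrow> a * x \<in> generated_ideal A S"
| right: "\<lbrakk>x \<in> generated_ideal A S; a \<in> A\<rbrakk> \<Longrightarrow> x * a \<in> generated_ideal A S"

definition coset :: "('g, 'k::field) free_algebra set \<Rightarrow> ('g, 'k) free_algebra
    \<Rightarrow> ('g, 'k) free_algebra set" where
  "coset I p = (\<lambda>q. p + q) ` I"

text \<open>The products of representatives of two cosets all lie in the same coset of \<open>I\<close>, so the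
  unions below are single cosets.\<close>

definition quotient_algebra :: "('g, 'k::field) free_algebra set \<Rightarrow> ('g, 'k) free_algebra set
    \<Rightarrow> ('k, ('g, 'k) free_algebra set) nonunital_algebra" where
  "quotient_algebra A I = \<lparr>
     acarrier = coset I ` A,
     azero = coset I 0,
     aadd = (\<lambda>P Q. \<Union>p\<in>P. \<Union>q\<in>Q. coset I (p + q)),
     amult = (\<lambda>P Q. \<Union>p\<in>P. \<Union>q\<in>Q. coset I (p * q)),
     ascale = (\<lambda>c P. \<Union>p\<in>P. coset I (scalar_mult c p))\<rparr>"

text \<open>For a digraph \<open>E\<close>: \<open>E\<^sup>0 = verts E\<close>, \<open>E\<^sup>1 = arcs E\<close>, \<open>s = tail E\<close>, \<open>r = head E\<close>;
  loops and parallel edges are allowed.\<close>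

datatype ('v, 'e) leavitt_generator = Vertex 'v | Edge 'e | Ghost 'e

definition leavitt_generators :: "('v, 'e) pre_digraph \<Rightarrow> ('v, 'e) leavitt_generator set" where
  "leavitt_generators E = Vertex ` verts E \<union> Edge ` arcs E \<union> Ghost ` arcs E"

text \<open>Each relation \<open>x = y\<close> is recorded as \<open>x - y\<close>.\<close>

inductive_set leavitt_relations ::
    "('v, 'e) pre_digraph \<Rightarrow> (('v, 'e) leavitt_generator, 'k::field) free_algebra set"
  for E where
  vertex_idem: "v \<in> verts E \<Longrightarrow>
    generator (Vertex v) * generator (Vertex v) - generator (Vertex v) \<in> leavitt_relations E"
| vertex_orth: "\<lbrakk>v \<in> verts E; w \<in> verts E; v \<noteq> w\<rbrakk> \<Longrightarrow>
    generator (Vertex v) * generator (Vertex w) \<in> leavitt_relations E"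
| source_edge: "e \<in> arcs E \<Longrightarrow>
    generator (Vertex (tail E e)) * generator (Edge e) - generator (Edge e) \<in> leavitt_relations E"
| edge_range: "e \<in> arcs E \<Longrightarrow>
    generator (Edge e) * generator (Vertex (head E e)) - generator (Edge e) \<in> leavitt_relations E"
| range_ghost: "e \<in> arcs E \<Longrightarrow>
    generator (Vertex (head E e)) * generator (Ghost e) - generator (Ghost e)
      \<in> leavitt_relations E"
| ghost_source: "e \<in> arcs E \<Longrightarrow>
    generator (Ghost e) * generator (Vertex (tail E e)) - generator (Ghost e)
      \<in> leavitt_relations E"
| ghost_edge_same: "e \<in> arcs E \<Longrightarrow>
    generator (Ghost e) * generator (Edge e) - generator (Vertex (head E e))
      \<in> leavitt_relations E"
| ghost_edge_diff: "\<lbrakk>e \<in> arcs E; f \<in> arcs E; e \<noteq> f\<rbrakk> \<Longrightarrow>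
    generator (Ghost e) * generator (Edge f) \<in> leavitt_relations E"
| cuntz_krieger: "\<lbrakk>v \<in> verts E; finite (out_arcs E v); out_arcs E v \<noteq> {}\<rbrakk> \<Longrightarrow>
    generator (Vertex v) - (\<Sum>e\<in>out_arcs E v. generator (Edge e) * generator (Ghost e))
      \<in> leavitt_relations E"

definition leavitt_ideal ::
    "('v, 'e) pre_digraph \<Rightarrow> (('v, 'e) leavitt_generator, 'k::field) free_algebra set" where
  "leavitt_ideal E = generated_ideal (free_nonunital (leavitt_generators E)) (leavitt_relations E)"

definition leavitt_path_algebra :: "('v, 'e) pre_digraph
    \<Rightarrow> ('k::field, (('v, 'e) leavitt_generator, 'k) free_algebra set) nonunital_algebra" where
  "leavitt_path_algebra E =
     quotient_algebra (free_nonunital (leavitt_generators E)) (leavitt_ideal E)"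

definition leavitt_gen :: "('v, 'e) pre_digraph \<Rightarrow> ('v, 'e) leavitt_generator
    \<Rightarrow> (('v, 'e) leavitt_generator, 'k::field) free_algebra set" where
  "leavitt_gen E g = coset (leavitt_ideal E) (generator g)"


lemma UN_const_eq: "\<lbrakk>B \<noteq> {}; \<And>x. x \<in> B \<Longrightarrow> F x = c\<rbrakk> \<Longrightarrow> (\<Union>x\<in>B. F x) = c"
  by auto

lemma single_zero_commute:
  fixes p :: "('g, 'k::field) free_algebra"
  shows "p * Poly_Mapping.single 0 c = Poly_Mapping.single 0 c * p"
proof (induction p rule: update_induct)
  case const
  show ?case by simp
next
  case (update p m d)
  have "Poly_Mapping.update m d p = Poly_Mapping.single m d + p"
    using update(1)
    by (intro poly_mapping_eqI)
       (auto simp: lookup_update lookup_add lookup_single in_keys_iff when_def)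
  then show ?case using update(3) by (simp add: distrib_left distrib_right mult_single mult.commute)
qed

lemma scalar_mult_add: "scalar_mult c (p + q) = scalar_mult c p + scalar_mult c q"
  by (simp add: scalar_mult_def algebra_simps)

lemma scalar_mult_diff: "scalar_mult c (p - q) = scalar_mult c p - scalar_mult c q"
  by (simp add: scalar_mult_def algebra_simps)

lemma scalar_mult_add_left: "scalar_mult (c + d) p = scalar_mult c p + scalar_mult d p"
  by (simp add: scalar_mult_def single_add algebra_simps)

lemma scalar_mult_scalar_mult: "scalar_mult c (scalar_mult d p) = scalar_mult (c * d) p"
  by (simp add: scalar_mult_def mult_single flip: mult.assoc)

lemma scalar_mult_one: "scalar_mult 1 p = p"
  by (simp add: scalar_mult_def)

lemma scalar_mult_minus_one: "scalar_mult (- 1) p = - p"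
  by (simp add: scalar_mult_def single_uminus)

lemma scalar_mult_times_left: "scalar_mult c p * q = scalar_mult c (p * q)"
  by (simp add: scalar_mult_def mult.assoc)

lemma scalar_mult_times_right: "p * scalar_mult c q = scalar_mult c (p * q)"
  by (simp add: scalar_mult_def single_zero_commute flip: mult.assoc)

lemma free_nonunital_zero: "0 \<in> free_nonunital G"
  by (simp add: free_nonunital_def)

lemma free_nonunital_add:
  "\<lbrakk>p \<in> free_nonunital G; q \<in> free_nonunital G\<rbrakk> \<Longrightarrow> p + q \<in> free_nonunital G"
  using keys_add[of p q] by (auto simp: free_nonunital_def)

lemma free_nonunital_mult:
  "\<lbrakk>p \<in> free_nonunital G; q \<in> free_nonunital G\<rbrakk> \<Longrightarrow> p * q \<in> free_nonunital G"
  using keys_mult[of p q]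
  by (fastforce simp: free_nonunital_def zero_monomial_def plus_monomial_def monomial.expand)

lemma free_nonunital_scale: "p \<in> free_nonunital G \<Longrightarrow> scalar_mult c p \<in> free_nonunital G"
  using keys_mult[of "Poly_Mapping.single 0 c" p]
  by (fastforce simp: free_nonunital_def scalar_mult_def split: if_splits)

lemma generator_mem: "g \<in> G \<Longrightarrow> generator g \<in> free_nonunital G"
  by (simp add: free_nonunital_def generator_def zero_monomial_def)

context
  fixes G :: "'g set" and S :: "('g, 'k::field) free_algebra set"
begin

private abbreviation (input) "A \<equiv> free_nonunital G :: ('g, 'k) free_algebra set"
private abbreviation (input) "I \<equiv> generated_ideal A S"

lemma generated_ideal_minus: "x \<in> I \<Longrightarrow> - x \<in> I"
  using generated_ideal.scale[of x A S "- 1"] by (simp add: scalar_mult_minus_one)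

lemma mem_coset: "q \<in> coset I p \<longleftrightarrow> q - p \<in> I"
  unfolding coset_def image_iff by (metis add_diff_cancel_left' diff_add_cancel add.commute)

lemma coset_eq_iff: "coset I p = coset I q \<longleftrightarrow> p - q \<in> I"
proof
  assume "coset I p = coset I q"
  then have "p \<in> coset I q" using generated_ideal.zero by (metis diff_self mem_coset)
  then show "p - q \<in> I" by (simp add: mem_coset)
next
  assume pq: "p - q \<in> I"
  have "x - p \<in> I \<longleftrightarrow> x - q \<in> I" for x
    using generated_ideal.add[OF _ pq, of "x - p"]
      generated_ideal.add[OF _ generated_ideal_minus[OF pq], of "x - q"] by auto
  then show "coset I p = coset I q" by (auto simp: mem_coset)
qed

lemma coset_rep: "p' \<in> coset I p \<Longrightarrow> coset I p' = coset I p"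
  by (simp add: mem_coset coset_eq_iff)

lemma coset_self: "p \<in> coset I p"
  by (simp add: mem_coset generated_ideal.zero)

lemma coset_nonempty: "coset I p \<noteq> {}"
  using coset_self by blast

lemma quotient_add: "aadd (quotient_algebra A I) (coset I p) (coset I q) = coset I (p + q)"
proof -
  have h: "coset I (p' + q') = coset I (p + q)" if "p' \<in> coset I p" "q' \<in> coset I q" for p' q'
    using that generated_ideal.add[of "p' - p" A S "q' - q"]
    by (simp add: mem_coset coset_eq_iff algebra_simps)
  show ?thesis
    unfolding quotient_algebra_def nonunital_algebra.simps by (auto intro!: UN_const_eq h coset_nonempty)
qed

lemma quotient_scale: "ascale (quotient_algebra A I) c (coset I p) = coset I (scalar_mult c p)"
proof -
  have h: "coset I (scalar_mult c p') = coset I (scalar_mult c p)" if "p' \<in> coset I p" for p'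
    using that generated_ideal.scale[of "p' - p" A S c]
    by (simp add: mem_coset coset_eq_iff scalar_mult_diff)
  show ?thesis
    unfolding quotient_algebra_def nonunital_algebra.simps by (auto intro!: UN_const_eq h coset_nonempty)
qed

lemma generated_ideal_subset:
  assumes "S \<subseteq> A" "x \<in> I" shows "x \<in> A"
  using assms(2) by (induction rule: generated_ideal.induct)
    (use assms(1) in \<open>auto simp: free_nonunital_zero free_nonunital_add free_nonunital_mult
      free_nonunital_scale\<close>)

lemma quotient_mult:
  assumes "S \<subseteq> A" and p: "p \<in> A" and q: "q \<in> A"
  shows "amult (quotient_algebra A I) (coset I p) (coset I q) = coset I (p * q)"
proof -
  have h: "coset I (p' * q') = coset I (p * q)" if pq: "p' \<in> coset I p" "q' \<in> coset I q" for p' q'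
  proof -
    have "p' - p \<in> I" "q' - q \<in> I" using pq by (simp_all add: mem_coset)
    moreover from this have "q' - q \<in> A" using generated_ideal_subset[OF assms(1)] by blast
    then have "q' \<in> A" using q free_nonunital_add by fastforce
    ultimately have "(p' - p) * q' + p * (q' - q) \<in> I"
      using p by (intro generated_ideal.add generated_ideal.left generated_ideal.right)
    then show ?thesis by (simp add: coset_eq_iff algebra_simps)
  qed
  show ?thesis
    unfolding quotient_algebra_def nonunital_algebra.simps by (auto intro!: UN_const_eq h coset_nonempty)
qed

lemma quotient_algebra_is_algebra:
  assumes "S \<subseteq> A" shows "nonunital_algebra (quotient_algebra A I)"
proof -
  have c: "acarrier (quotient_algebra A I) = coset I ` A"
    and z: "azero (quotient_algebra A I) = coset I 0"
    by (simp_all add: quotient_algebra_def)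
  note m = quotient_mult[OF assms]
  show ?thesis
    by unfold_locales
       (auto simp: c z m quotient_add quotient_scale free_nonunital_zero free_nonunital_add
         free_nonunital_mult free_nonunital_scale scalar_mult_add scalar_mult_add_left
         scalar_mult_scalar_mult scalar_mult_one scalar_mult_minus_one scalar_mult_times_left
         scalar_mult_times_right algebra_simps)
qed

end

lemma leavitt_relations_subset:
  assumes "wf_digraph E"
  shows "(leavitt_relations E :: (_, 'k::field) free_algebra set) \<subseteq> free_nonunital (leavitt_generators E)"
proof
  interpret wf_digraph E by fact
  let ?A = "free_nonunital (leavitt_generators E) :: (_, 'k) free_algebra set"
  have diff: "p - q \<in> ?A" if "p \<in> ?A" "q \<in> ?A" for p q
    using free_nonunital_add[OF that(1) free_nonunital_scale[OF that(2), of "- 1"]]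
    by (simp add: scalar_mult_minus_one)
  have sum: "(\<Sum>i\<in>J. h i) \<in> ?A" if "\<And>i. i \<in> J \<Longrightarrow> h i \<in> ?A" for J :: "'b set" and h
    using that by (induction J rule: infinite_finite_induct)
      (auto simp: free_nonunital_zero free_nonunital_add)
  have gens: "v \<in> verts E \<Longrightarrow> generator (Vertex v) \<in> ?A" "e \<in> arcs E \<Longrightarrow> generator (Edge e) \<in> ?A"
    "e \<in> arcs E \<Longrightarrow> generator (Ghost e) \<in> ?A" for v e
    by (auto intro!: generator_mem simp: leavitt_generators_def)
  fix x :: "(_, 'k) free_algebra" assume "x \<in> leavitt_relations E"
  then show "x \<in> ?A"
    by cases (auto intro!: diff sum free_nonunital_mult gens)
qed

lemma leavitt_path_algebra_is_algebra:
  "wf_digraph E \<Longrightarrow> nonunital_algebra (leavitt_path_algebra E)"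
  unfolding leavitt_path_algebra_def leavitt_ideal_def
  by (rule quotient_algebra_is_algebra[OF leavitt_relations_subset])


section \<open>The module of functions and its endomorphism algebra\<close>

text \<open>A function \<open>X \<rightarrow> K\<close> is represented by its extension by \<open>0\<close> to the whole type, with the
  pointwise operations.\<close>

definition functions_on :: "'x set \<Rightarrow> ('x \<Rightarrow> 'k::field) set" where
  "functions_on X = {\<phi>. \<forall>x. x \<notin> X \<longrightarrow> \<phi> x = 0}"

text \<open>Maps \<open>M \<rightarrow> M\<close> are extensional, i.e. \<open>undefined\<close> outside \<open>M\<close>, so that equality of
  endomorphisms is equality on \<open>M\<close>.\<close>

definition Hom :: "('x \<Rightarrow> 'k::field) set
    \<Rightarrow> ('k, ('x \<Rightarrow> 'k) \<Rightarrow> ('x \<Rightarrow> 'k)) nonunital_algebra" where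
  "Hom M = \<lparr>
     acarrier = {T \<in> M \<rightarrow>\<^sub>E M.
        (\<forall>\<phi>\<in>M. \<forall>\<psi>\<in>M. T (\<lambda>x. \<phi> x + \<psi> x) = (\<lambda>x. T \<phi> x + T \<psi> x))
        \<and> (\<forall>c. \<forall>\<phi>\<in>M. T (\<lambda>x. c * \<phi> x) = (\<lambda>x. c * T \<phi> x))},
     azero = (\<lambda>\<phi>\<in>M. \<lambda>x. 0),
     aadd = (\<lambda>S T. \<lambda>\<phi>\<in>M. \<lambda>x. S \<phi> x + T \<phi> x),
     amult = (\<lambda>S T. compose M S T),
     ascale = (\<lambda>c T. \<lambda>\<phi>\<in>M. \<lambda>x. c * T \<phi> x)\<rparr>"


lemma Hom_carrier:
  "T \<in> acarrier (Hom M) \<longleftrightarrow> (\<forall>\<phi>. if \<phi> \<in> M then T \<phi> \<in> M else T \<phi> = undefined)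
     \<and> (\<forall>\<phi>\<in>M. \<forall>\<psi>\<in>M. T (\<lambda>x. \<phi> x + \<psi> x) = (\<lambda>x. T \<phi> x + T \<psi> x))
     \<and> (\<forall>c. \<forall>\<phi>\<in>M. T (\<lambda>x. c * \<phi> x) = (\<lambda>x. c * T \<phi> x))"
  unfolding Hom_def by (auto simp: PiE_def Pi_def extensional_def)

lemma functions_on_closed:
  "(\<lambda>x. 0) \<in> functions_on X"
  "\<lbrakk>\<phi> \<in> functions_on X; \<psi> \<in> functions_on X\<rbrakk> \<Longrightarrow> (\<lambda>x. \<phi> x + \<psi> x) \<in> functions_on X"
  "\<phi> \<in> functions_on X \<Longrightarrow> (\<lambda>x. c * \<phi> x) \<in> functions_on X"
  by (auto simp: functions_on_def)

lemma Hom_is_algebra: "nonunital_algebra (Hom (functions_on X :: ('x \<Rightarrow> 'k::field) set))"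
proof -
  let ?M = "functions_on X :: ('x \<Rightarrow> 'k) set"
  have ops: "azero (Hom ?M) = (\<lambda>\<phi>. if \<phi> \<in> ?M then (\<lambda>x. 0) else undefined)"
    "aadd (Hom ?M) S T = (\<lambda>\<phi>. if \<phi> \<in> ?M then (\<lambda>x. S \<phi> x + T \<phi> x) else undefined)"
    "amult (Hom ?M) S T = (\<lambda>\<phi>. if \<phi> \<in> ?M then S (T \<phi>) else undefined)"
    "ascale (Hom ?M) c T = (\<lambda>\<phi>. if \<phi> \<in> ?M then (\<lambda>x. c * T \<phi> x) else undefined)" for S T c
    by (simp_all add: Hom_def restrict_def compose_def)
  note cl = functions_on_closed
  have map: "T \<phi> \<in> ?M" if "T \<in> acarrier (Hom ?M)" "\<phi> \<in> ?M" for T \<phi>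
    using that Hom_carrier[of T ?M] by (auto split: if_splits)
  have out: "T \<phi> = undefined" if "T \<in> acarrier (Hom ?M)" "\<phi> \<notin> ?M" for T \<phi>
    using that Hom_carrier[of T ?M] by (auto split: if_splits)
  have add: "T (\<lambda>x. \<phi> x + \<psi> x) = (\<lambda>x. T \<phi> x + T \<psi> x)"
    if "T \<in> acarrier (Hom ?M)" "\<phi> \<in> ?M" "\<psi> \<in> ?M" for T \<phi> \<psi>
    using that Hom_carrier[of T ?M] by blast
  have scale: "T (\<lambda>x. c * \<phi> x) = (\<lambda>x. c * T \<phi> x)"
    if "T \<in> acarrier (Hom ?M)" "\<phi> \<in> ?M" for T \<phi> c
    using that Hom_carrier[of T ?M] by blast
  show ?thesis
  proof
    show "azero (Hom ?M) \<in> acarrier (Hom ?M)"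
      by (simp add: Hom_carrier ops cl)
  next
    fix S T assume "S \<in> acarrier (Hom ?M)" "T \<in> acarrier (Hom ?M)"
    then show "aadd (Hom ?M) S T \<in> acarrier (Hom ?M)"
      by (subst Hom_carrier) (simp add: ops cl map add scale algebra_simps)
  next
    fix S T assume "S \<in> acarrier (Hom ?M)" "T \<in> acarrier (Hom ?M)"
    then show "amult (Hom ?M) S T \<in> acarrier (Hom ?M)"
      by (subst Hom_carrier) (simp add: ops cl map add scale)
  next
    fix T c assume "T \<in> acarrier (Hom ?M)"
    then show "ascale (Hom ?M) c T \<in> acarrier (Hom ?M)"
      by (subst Hom_carrier) (simp add: ops cl map add scale algebra_simps)
  qed (auto simp: ops map out add scale cl fun_eq_iff algebra_simps)
qed


section \<open>Branching systems\<close>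

locale algebraic_branching_system = wf_digraph E
  for E :: "('v, 'e) pre_digraph" (structure) +
  fixes X :: "'x set" and R :: "'e \<Rightarrow> 'x set" and D :: "'v \<Rightarrow> 'x set" and f :: "'e \<Rightarrow> 'x \<Rightarrow> 'x"
  assumes R_subset: "e \<in> arcs E \<Longrightarrow> R e \<subseteq> X"
    and D_subset: "v \<in> verts E \<Longrightarrow> D v \<subseteq> X"
    and R_disjoint: "disjoint_family_on R (arcs E)"
    and D_disjoint: "disjoint_family_on D (verts E)"
    and R_subset_D: "e \<in> arcs E \<Longrightarrow> R e \<subseteq> D (tail E e)"
    and D_eq: "\<lbrakk>v \<in> verts E; finite (out_arcs E v); out_arcs E v \<noteq> {}\<rbrakk>
          \<Longrightarrow> D v = (\<Union>e\<in>out_arcs E v. R e)"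
    and f_bij: "e \<in> arcs E \<Longrightarrow> bij_betw (f e) (D (head E e)) (R e)"

definition sinks :: "('v, 'e) pre_digraph \<Rightarrow> 'v set" where
  "sinks E = {v \<in> verts E. out_arcs E v = {}}"

text \<open>\<open>n\<close> assigns to each \<open>a \<in> A\<close> its position in an enumeration \<open>a\<^sub>1, a\<^sub>2, \<dots>\<close> of \<open>A\<close>
  without repetition; positions start at \<open>1\<close>.\<close>

definition enumerates :: "('a \<Rightarrow> nat) \<Rightarrow> 'a set \<Rightarrow> bool" where
  "enumerates n A \<longleftrightarrow> bij_betw n A (if finite A then {1..card A} else {1..})"

locale interval_construction = wf_digraph E
  for E :: "('v, 'e) pre_digraph" (structure) +
  fixes edge_no :: "'e \<Rightarrow> nat" and sink_no :: "'v \<Rightarrow> nat"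
    and X :: "real set" and R :: "'e \<Rightarrow> real set" and D :: "'v \<Rightarrow> real set"
    and f :: "'e \<Rightarrow> real \<Rightarrow> real"
  assumes edge_no: "enumerates edge_no (arcs E)"
    and sink_no: "enumerates sink_no (sinks E)"
    and R_eq: "e \<in> arcs E \<Longrightarrow> R e = {real (edge_no e) - 1..<real (edge_no e)}"
    and D_sink: "v \<in> sinks E \<Longrightarrow> D v = {- real (sink_no v)..<- real (sink_no v) + 1}"
    and D_nonsink: "u \<in> verts E - sinks E \<Longrightarrow> D u = (\<Union>e\<in>out_arcs E u. R e)"
    and f_sink: "\<lbrakk>e \<in> arcs E; head E e \<in> sinks E\<rbrakk> \<Longrightarrow> bij_betw (f e) (D (head E e)) (R e)"
    and f_nonsink: "\<lbrakk>e \<in> arcs E; head E e \<notin> sinks E\<rbrakk> \<Longrightarrow>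
          \<exists>I. disjoint_family_on I (out_arcs E (head E e))
            \<and> (\<Union>d\<in>out_arcs E (head E e). I d) = R e
            \<and> (\<forall>d\<in>out_arcs E (head E e).
                 (\<exists>a b. I d = {a..<b}) \<and> bij_betw (f e) (R d) (I d))"
    and X_eq: "X = (\<Union>e\<in>arcs E. R e) \<union> (\<Union>v\<in>sinks E. D v)"

lemma (in interval_construction) D_nonsink_mem:
  "\<lbrakk>u \<in> verts E; out_arcs E u \<noteq> {}\<rbrakk> \<Longrightarrow> D u = (\<Union>e\<in>out_arcs E u. R e)"
  using D_nonsink by (simp add: sinks_def)

lemma (in interval_construction) edge_no_pos: "e \<in> arcs E \<Longrightarrow> edge_no e \<ge> 1"
  using edge_no unfolding enumerates_def bij_betw_def by (force split: if_splits)

lemma (in interval_construction) sink_no_pos: "v \<in> sinks E \<Longrightarrow> sink_no v \<ge> 1"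
  using sink_no unfolding enumerates_def bij_betw_def by (force split: if_splits)

lemma unit_intervals_disjoint:
  fixes x :: real
  assumes "x \<in> {real m - 1..<real m}" "x \<in> {real n - 1..<real n}" shows "m = n"
proof -
  have "real m < real n + 1" "real n < real m + 1" using assms by auto
  then show ?thesis by linarith
qed

lemma (in interval_construction) R_unique:
  assumes "e \<in> arcs E" "d \<in> arcs E" "x \<in> R e" "x \<in> R d" shows "e = d"
proof -
  have "edge_no e = edge_no d"
    using assms unit_intervals_disjoint[of x "edge_no e" "edge_no d"] by (simp add: R_eq)
  then show ?thesis
    using edge_no assms by (auto simp: enumerates_def bij_betw_def dest: inj_onD split: if_splits)
qed

lemma (in interval_construction) sink_unique:
  assumes "v \<in> sinks E" "w \<in> sinks E" "x \<in> D v" "x \<in> D w" shows "v = w"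
proof -
  have "real (sink_no v) < real (sink_no w) + 1" "real (sink_no w) < real (sink_no v) + 1"
    using assms by (auto simp: D_sink)
  then have "sink_no v = sink_no w" by linarith
  then show ?thesis
    using sink_no assms by (auto simp: enumerates_def bij_betw_def dest: inj_onD split: if_splits)
qed

lemma (in interval_construction) D_sink_neg: "\<lbrakk>v \<in> sinks E; x \<in> D v\<rbrakk> \<Longrightarrow> x < 0"
  using sink_no_pos[of v] by (auto simp: D_sink)

lemma (in interval_construction) R_nonneg: "\<lbrakk>e \<in> arcs E; x \<in> R e\<rbrakk> \<Longrightarrow> x \<ge> 0"
  using edge_no_pos[of e] by (auto simp: R_eq)

lemma (in interval_construction) D_cases:
  assumes "v \<in> verts E" "x \<in> D v"
  shows "(v \<in> sinks E \<and> x < 0) \<or> (\<exists>e\<in>arcs E. tail E e = v \<and> x \<in> R e \<and> x \<ge> 0)"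
proof (cases "v \<in> sinks E")
  case True then show ?thesis using assms D_sink_neg by auto
next
  case False
  then show ?thesis using assms D_nonsink R_nonneg by fastforce
qed

sublocale interval_construction \<subseteq> algebraic_branching_system E X R D f
proof
  show "R e \<subseteq> X" if "e \<in> arcs E" for e using that X_eq by auto
  show "D v \<subseteq> X" if "v \<in> verts E" for v
    using that X_eq D_nonsink[of v] by (cases "v \<in> sinks E") auto
  show "disjoint_family_on R (arcs E)"
    using R_unique by (fastforce simp: disjoint_family_on_def)
  show "disjoint_family_on D (verts E)"
    unfolding disjoint_family_on_def
  proof (intro ballI impI, rule ccontr)
    fix v w assume vw: "v \<in> verts E" "w \<in> verts E" "v \<noteq> w" "D v \<inter> D w \<noteq> {}"
    then obtain x where "x \<in> D v" "x \<in> D w" by auto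
    then show False
      using D_cases[of v x] D_cases[of w x] vw sink_unique[of v w x] R_unique by fastforce
  qed
  show "R e \<subseteq> D (tail E e)" if "e \<in> arcs E" for e
  proof -
    have "e \<in> out_arcs E (tail E e)" using that by simp
    then show ?thesis using D_nonsink_mem[OF tail_in_verts[OF that]] by blast
  qed
  show "D v = (\<Union>e\<in>out_arcs E v. R e)" if "v \<in> verts E" "out_arcs E v \<noteq> {}" for v
    using that D_nonsink_mem by auto
  show "bij_betw (f e) (D (head E e)) (R e)" if e: "e \<in> arcs E" for e
  proof (cases "head E e \<in> sinks E")
    case True then show ?thesis using f_sink e by blast
  next
    case False
    define S where "S = out_arcs E (head E e)"
    have S: "S \<subseteq> arcs E" by (auto simp: S_def)
    obtain I where I: "disjoint_family_on I S" "(\<Union>d\<in>S. I d) = R e"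
        "\<And>d. d \<in> S \<Longrightarrow> bij_betw (f e) (R d) (I d)"
      using f_nonsink[OF e False] unfolding S_def by blast
    have D: "D (head E e) = (\<Union>d\<in>S. R d)"
      using D_nonsink[of "head E e"] e False by (auto simp: S_def)
    have "inj_on (f e) (\<Union>d\<in>S. R d)"
    proof (rule inj_onI)
      fix x y assume "x \<in> (\<Union>d\<in>S. R d)" "y \<in> (\<Union>d\<in>S. R d)" and eq: "f e x = f e y"
      then obtain c d where cd: "c \<in> S" "x \<in> R c" "d \<in> S" "y \<in> R d" by auto
      have "f e x \<in> I c" "f e y \<in> I d" using cd I(3) by (auto simp: bij_betw_def)
      then have "c = d" using I(1) cd eq by (auto simp: disjoint_family_on_def)
      then show "x = y" using cd eq I(3)[of c] by (auto simp: bij_betw_def inj_on_def)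
    qed
    moreover have "f e ` (\<Union>d\<in>S. R d) = R e"
      using I(2,3) by (simp add: image_UN bij_betw_def)
    ultimately show ?thesis by (simp add: D bij_betw_def)
  qed
qed

end

theory Submission
  imports Defs
begin

text \<open>The operators attached to the vertices, edges and ghost edges are linear on all functions
  \<open>'x \<Rightarrow> 'k\<close>, not only on those supported in \<open>X\<close>. They therefore extend to words and to the whole
  free algebra by composition and linearity. The branching system axioms say exactly that this
  extension kills the Leavitt relations, so it factors through the quotient; restricting to
  functions supported in \<open>X\<close> gives the representation.\<close>

section \<open>Evaluation of the free algebra on operators\<close>

text \<open>Updating a fresh key amounts to adding a single term. The step is phrased as addition of
  an arbitrary term, so that distributivity applies directly when products are expanded.\<close>

lemma free_algebra_induct [case_names zero add_single]:
  assumes "P 0" and "\<And>m c p. P p \<Longrightarrow> P (Poly_Mapping.single m c + p)"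
  shows "P (p :: ('g, 'k::field) free_algebra)"
proof (induction p rule: update_induct)
  case const
  show ?case by (fact assms(1))
next
  case (update p m d)
  have "Poly_Mapping.update m d p = Poly_Mapping.single m d + p"
    using update(1)
    by (intro poly_mapping_eqI)
       (auto simp: lookup_update lookup_add lookup_single in_keys_iff when_def)
  then show ?case using assms(2) update(3) by simp
qed

locale linear_operators =
  fixes T :: "'g \<Rightarrow> ('x \<Rightarrow> 'k::field) \<Rightarrow> 'x \<Rightarrow> 'k"
  assumes T_add: "T g (\<lambda>x. \<phi> x + \<psi> x) = (\<lambda>x. T g \<phi> x + T g \<psi> x)"
    and T_scale: "T g (\<lambda>x. c * \<phi> x) = (\<lambda>x. c * T g \<phi> x)"
begin

text \<open>The leftmost letter acts last, so concatenation of words becomes composition of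
  operators.\<close>

definition word_op :: "'g monomial \<Rightarrow> ('x \<Rightarrow> 'k) \<Rightarrow> 'x \<Rightarrow> 'k" where
  "word_op m = foldr T (letters m)"

lemma word_op_plus: "word_op (m + n) \<phi> = word_op m (word_op n \<phi>)"
  by (simp add: word_op_def plus_monomial_def)

lemma word_op_zero: "word_op 0 \<phi> = \<phi>"
  by (simp add: word_op_def zero_monomial_def)

lemma word_op_add: "word_op m (\<lambda>x. \<phi> x + \<psi> x) = (\<lambda>x. word_op m \<phi> x + word_op m \<psi> x)"
proof -
  have "foldr T ws (\<lambda>x. \<phi> x + \<psi> x) = (\<lambda>x. foldr T ws \<phi> x + foldr T ws \<psi> x)" for ws
    by (induction ws) (simp_all add: T_add)
  then show ?thesis by (simp add: word_op_def)
qed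

lemma word_op_scale: "word_op m (\<lambda>x. c * \<phi> x) = (\<lambda>x. c * word_op m \<phi> x)"
proof -
  have "foldr T ws (\<lambda>x. c * \<phi> x) = (\<lambda>x. c * foldr T ws \<phi> x)" for ws
    by (induction ws) (simp_all add: T_scale)
  then show ?thesis by (simp add: word_op_def)
qed

definition eval_op :: "('g, 'k) free_algebra \<Rightarrow> ('x \<Rightarrow> 'k) \<Rightarrow> 'x \<Rightarrow> 'k" where
  "eval_op p \<phi> x = (\<Sum>m\<in>Poly_Mapping.keys p. Poly_Mapping.lookup p m * word_op m \<phi> x)"

text \<open>Coefficients vanish off the keys. Cancellation can make the keys of \<open>p + q\<close>
  smaller than the union of those of \<open>p\<close> and \<open>q\<close>; this lets all three sums
  run over one index set.\<close>

lemma eval_op_superset: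
  assumes "finite J" "Poly_Mapping.keys p \<subseteq> J"
  shows "eval_op p \<phi> x = (\<Sum>m\<in>J. Poly_Mapping.lookup p m * word_op m \<phi> x)"
  unfolding eval_op_def by (rule sum.mono_neutral_left) (use assms in \<open>auto simp: in_keys_iff\<close>)

lemma eval_op_zero: "eval_op 0 \<phi> x = 0"
  by (simp add: eval_op_def)

lemma eval_op_plus: "eval_op (p + q) \<phi> x = eval_op p \<phi> x + eval_op q \<phi> x"
proof -
  define J where "J = Poly_Mapping.keys p \<union> Poly_Mapping.keys q"
  have J: "finite J" "Poly_Mapping.keys p \<subseteq> J" "Poly_Mapping.keys q \<subseteq> J"
    "Poly_Mapping.keys (p + q) \<subseteq> J"
    using keys_add[of p q] by (auto simp: J_def)
  show ?thesis
    unfolding J(2-4)[THEN eval_op_superset[OF J(1)]]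
    by (simp add: lookup_add distrib_right sum.distrib)
qed

lemma eval_op_single: "eval_op (Poly_Mapping.single m c) \<phi> x = c * word_op m \<phi> x"
  by (simp add: eval_op_def)

lemma eval_op_diff: "eval_op (p - q) \<phi> x = eval_op p \<phi> x - eval_op q \<phi> x"
  using eval_op_plus[of "p - q" q \<phi> x] by simp

lemma eval_op_sum: "eval_op (\<Sum>j\<in>J. p j) \<phi> x = (\<Sum>j\<in>J. eval_op (p j) \<phi> x)"
  by (induction J rule: infinite_finite_induct) (simp_all add: eval_op_zero eval_op_plus)

lemma eval_op_arg_add: "eval_op p (\<lambda>x. \<phi> x + \<psi> x) x = eval_op p \<phi> x + eval_op p \<psi> x"
  by (simp add: eval_op_def word_op_add distrib_left sum.distrib)

lemma eval_op_arg_scale: "eval_op p (\<lambda>x. c * \<phi> x) x = c * eval_op p \<phi> x"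
  by (simp add: eval_op_def word_op_scale sum_distrib_left mult.left_commute)

text \<open>First half of multiplicativity: with a single term on the left, induction on the right
  factor uses only linearity of \<open>word_op m\<close>. Induction on the left factor then yields
  \<open>eval_op_times\<close>.\<close>

lemma eval_op_single_times:
  "eval_op (Poly_Mapping.single m c * q) \<phi> x = c * word_op m (eval_op q \<phi>) x"
proof (induction q arbitrary: x rule: free_algebra_induct)
  case zero
  \<comment> \<open>The zero function is written as a multiple by \<open>0\<close>, so that
    \<open>word_op_scale\<close> shows that \<open>word_op m\<close> maps it to zero.\<close>
  have "eval_op 0 \<phi> = (\<lambda>x. 0 * \<phi> x)" by (simp add: eval_op_zero fun_eq_iff)
  then show ?case by (simp only: word_op_scale) (simp add: eval_op_zero)
next
  case (add_single n d q)
  have "eval_op (Poly_Mapping.single n d + q) \<phi> = (\<lambda>x. d * word_op n \<phi> x + eval_op q \<phi> x)"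
    by (simp add: eval_op_plus eval_op_single fun_eq_iff)
  then show ?case
    by (simp add: distrib_left eval_op_plus add_single mult_single eval_op_single word_op_plus
        word_op_add word_op_scale mult.assoc)
qed

lemma eval_op_times: "eval_op (p * q) \<phi> = eval_op p (eval_op q \<phi>)"
proof (induction p rule: free_algebra_induct)
  case zero
  show ?case by (simp add: eval_op_zero fun_eq_iff)
next
  case (add_single m c p)
  then show ?case
    by (simp add: distrib_right eval_op_plus eval_op_single eval_op_single_times fun_eq_iff)
qed

lemma eval_op_scalar_mult: "eval_op (scalar_mult c p) \<phi> x = c * eval_op p \<phi> x"
  by (simp add: scalar_mult_def eval_op_single_times word_op_zero)

lemma eval_op_generator: "eval_op (generator g) \<phi> = T g \<phi>"
  by (simp add: generator_def eval_op_single word_op_def fun_eq_iff)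

lemma eval_op_arg_zero: "eval_op p (\<lambda>x. 0) x = 0"
  using eval_op_arg_scale[of p 0 "\<lambda>x. 0" x] by simp

text \<open>The elements acting as zero form a two-sided ideal. Left multiples vanish because
  operators send zero to zero; for a right multiple by \<open>a\<close> the induction hypothesis is
  applied to \<open>eval_op a \<phi>\<close>, which is why \<open>\<phi>\<close> stays
  arbitrary.\<close>

lemma eval_op_generated_ideal:
  assumes "\<And>p \<phi> x. p \<in> S \<Longrightarrow> eval_op p \<phi> x = 0" and "p \<in> generated_ideal A S"
  shows "eval_op p \<phi> x = 0"
  using assms(2)
proof (induction arbitrary: \<phi> x rule: generated_ideal.induct)
  case (left a p)
  then have "eval_op p \<phi> = (\<lambda>x. 0)" by (simp add: fun_eq_iff)
  then show ?case by (simp add: eval_op_times eval_op_arg_zero)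
qed (simp_all add: assms(1) eval_op_zero eval_op_plus eval_op_scalar_mult eval_op_times)

lemma eval_op_functions_on:
  assumes "\<And>g \<phi>. \<lbrakk>g \<in> G; \<phi> \<in> functions_on X\<rbrakk> \<Longrightarrow> T g \<phi> \<in> functions_on X"
    and "p \<in> free_nonunital G" "\<phi> \<in> functions_on X"
  shows "eval_op p \<phi> \<in> functions_on X"
proof -
  have "foldr T ws \<phi> \<in> functions_on X" if "set ws \<subseteq> G" for ws
    using that by (induction ws) (simp_all add: assms(1,3))
  then have "word_op m \<phi> x = 0" if "m \<in> Poly_Mapping.keys p" "x \<notin> X" for m x
    using that assms(2) by (auto simp: word_op_def free_nonunital_def functions_on_def)
  then show ?thesis by (simp add: functions_on_def eval_op_def)
qed

text \<open>Evaluation is constant on cosets because the ideal acts as zero, hence it descends to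
  the quotient. Invariance under the generators in \<open>G\<close> makes the restriction to
  functions supported in \<open>X\<close> an endomorphism.\<close>

theorem quotient_algebra_representation:
  fixes S :: "('g, 'k) free_algebra set"
  assumes S: "S \<subseteq> free_nonunital G"
    and relations: "\<And>p \<phi> x. p \<in> S \<Longrightarrow> eval_op p \<phi> x = 0"
    and invariant: "\<And>g \<phi>. \<lbrakk>g \<in> G; \<phi> \<in> functions_on X\<rbrakk> \<Longrightarrow> T g \<phi> \<in> functions_on X"
  defines "I \<equiv> generated_ideal (free_nonunital G) S"
  shows "\<exists>\<pi> \<in> algebra_hom (quotient_algebra (free_nonunital G) I) (Hom (functions_on X)).
    \<forall>g. \<forall>\<phi>\<in>functions_on X. \<pi> (coset I (generator g)) \<phi> = T g \<phi>"
proof -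
  let ?A = "free_nonunital G :: ('g, 'k) free_algebra set"
  let ?Q = "quotient_algebra ?A I"
  let ?M = "functions_on X :: ('x \<Rightarrow> 'k) set"
  \<comment> \<open>An arbitrary representative is evaluated; the fact \<open>pi\<close> shows that
    the choice does not matter.\<close>
  define \<pi> where "\<pi> P = (\<lambda>\<phi>\<in>?M. eval_op (SOME p. p \<in> P) \<phi>)" for P
  have pi: "\<pi> (coset I p) = (\<lambda>\<phi>\<in>?M. eval_op p \<phi>)" for p
  proof -
    define q where "q = (SOME q. q \<in> coset I p)"
    have "q \<in> coset I p"
      unfolding q_def I_def by (rule someI[of "\<lambda>q. q \<in> coset _ p", OF coset_self])
    then have "eval_op (q - p) \<phi> x = 0" for \<phi> x
      unfolding I_def mem_coset using eval_op_generated_ideal[of S] relations by blast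
    then have "eval_op q = eval_op p" by (simp add: eval_op_diff fun_eq_iff)
    then show ?thesis by (simp add: \<pi>_def q_def)
  qed
  have closed: "eval_op p \<phi> \<in> ?M" if "p \<in> ?A" "\<phi> \<in> ?M" for p \<phi>
    using eval_op_functions_on[of G X] invariant that by blast
  note ops = quotient_add[of G S, folded I_def] quotient_scale[of G S, folded I_def]
    quotient_mult[OF S, folded I_def]
  have carrier: "acarrier ?Q = coset I ` ?A"
    by (simp add: quotient_algebra_def)
  have "\<pi> \<in> algebra_hom ?Q (Hom ?M)"
    unfolding algebra_hom_def carrier
  proof (intro CollectI conjI Pi_I ballI allI; elim imageE; hypsubst)
    fix c p q assume p: "p \<in> ?A" and q: "q \<in> ?A"
    show "\<pi> (coset I p) \<in> acarrier (Hom ?M)"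
      using p
      by (auto simp: Hom_carrier pi closed functions_on_closed eval_op_arg_add eval_op_arg_scale)
    show "\<pi> (aadd ?Q (coset I p) (coset I q)) = aadd (Hom ?M) (\<pi> (coset I p)) (\<pi> (coset I q))"
      unfolding ops pi Hom_def nonunital_algebra.simps
      by (intro restrict_ext ext) (simp add: eval_op_plus)
    show "\<pi> (amult ?Q (coset I p) (coset I q)) = amult (Hom ?M) (\<pi> (coset I p)) (\<pi> (coset I q))"
      \<comment> \<open>The product in \<open>Hom\<close> applies a restricted map to
        \<open>eval_op q \<phi>\<close>; this is a genuine value, not \<open>undefined\<close>,
        because that function lies in \<open>?M\<close> again.\<close>
      unfolding ops(3)[OF p q] pi Hom_def nonunital_algebra.simps compose_def
      by (intro restrict_ext) (simp add: eval_op_times closed q)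
    show "\<pi> (ascale ?Q c (coset I p)) = ascale (Hom ?M) c (\<pi> (coset I p))"
      unfolding ops pi Hom_def nonunital_algebra.simps
      by (intro restrict_ext ext) (simp add: eval_op_scalar_mult)
  qed
  moreover have "\<pi> (coset I (generator g)) \<phi> = T g \<phi>" if "\<phi> \<in> ?M" for g \<phi>
    using that by (simp add: pi eval_op_generator)
  ultimately show ?thesis by blast
qed

end

section \<open>Representations from branching systems\<close>

context algebraic_branching_system
begin

primrec branching_op :: "('v, 'e) leavitt_generator \<Rightarrow> ('x \<Rightarrow> 'k::field) \<Rightarrow> 'x \<Rightarrow> 'k" where
  "branching_op (Vertex v) \<phi> = (\<lambda>x. indicator (D v) x * \<phi> x)"
| "branching_op (Edge e) \<phi> =
     (\<lambda>x. if x \<in> R e then \<phi> (inv_into (D (head E e)) (f e) x) else 0)"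
| "branching_op (Ghost e) \<phi> = (\<lambda>x. if x \<in> D (head E e) then \<phi> (f e x) else 0)"

sublocale linear_operators "branching_op :: _ \<Rightarrow> ('x \<Rightarrow> 'k::field) \<Rightarrow> _"
proof
  fix g c and \<phi> \<psi> :: "'x \<Rightarrow> 'k"
  show "branching_op g (\<lambda>x. \<phi> x + \<psi> x) = (\<lambda>x. branching_op g \<phi> x + branching_op g \<psi> x)"
    by (cases g) (auto simp: algebra_simps)
  show "branching_op g (\<lambda>x. c * \<phi> x) = (\<lambda>x. c * branching_op g \<phi> x)"
    by (cases g) auto
qed

text \<open>Each operator cuts its result off outside some \<open>D v\<close> or \<open>R e\<close>,
  and these sets lie in \<open>X\<close>.\<close>

lemma branching_op_functions_on:
  assumes "g \<in> leavitt_generators E"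
  shows "branching_op g \<phi> \<in> functions_on X"
  using assms D_subset D_subset[OF head_in_verts] R_subset
  by (cases g) (auto simp: functions_on_def leavitt_generators_def indicator_def subset_iff)

lemma f_mem: "\<lbrakk>e \<in> arcs E; x \<in> D (head E e)\<rbrakk> \<Longrightarrow> f e x \<in> R e"
  using f_bij by (auto simp: bij_betw_def)

lemma inv_f_mem:
  "\<lbrakk>e \<in> arcs E; x \<in> R e\<rbrakk> \<Longrightarrow> inv_into (D (head E e)) (f e) x \<in> D (head E e)"
  using f_bij by (metis bij_betw_def inv_into_into)

lemma inv_f_f:
  "\<lbrakk>e \<in> arcs E; x \<in> D (head E e)\<rbrakk> \<Longrightarrow> inv_into (D (head E e)) (f e) (f e x) = x"
  using f_bij by (metis bij_betw_inv_into_left)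

lemma f_inv_f:
  "\<lbrakk>e \<in> arcs E; x \<in> R e\<rbrakk> \<Longrightarrow> f e (inv_into (D (head E e)) (f e) x) = x"
  using f_bij by (metis bij_betw_inv_into_right)

lemma R_disjointD: "\<lbrakk>e \<in> arcs E; d \<in> arcs E; x \<in> R e; x \<in> R d\<rbrakk> \<Longrightarrow> e = d"
  using R_disjoint by (auto simp: disjoint_family_on_def)

lemma D_disjointD: "\<lbrakk>v \<in> verts E; w \<in> verts E; x \<in> D v; x \<in> D w\<rbrakk> \<Longrightarrow> v = w"
  using D_disjoint by (auto simp: disjoint_family_on_def)

lemma edge_ghost_op:
  assumes "e \<in> arcs E"
  shows "branching_op (Edge e) (branching_op (Ghost e) \<phi>) x = (if x \<in> R e then \<phi> x else 0)"
  using assms by (simp add: inv_f_mem f_inv_f)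

text \<open>By disjointness at most one summand is nonzero. Together with
  \<open>edge_ghost_op\<close> this identifies the sum in the Cuntz-Krieger relation as the cut-off
  to the union of the \<open>R e\<close>.\<close>

lemma sum_over_R:
  assumes "finite J" "J \<subseteq> arcs E"
  shows "(\<Sum>e\<in>J. if x \<in> R e then c else 0) = (if x \<in> (\<Union>e\<in>J. R e) then c else (0::'k::field))"
proof (cases "\<exists>d\<in>J. x \<in> R d")
  case True
  then obtain d where d: "d \<in> J" "x \<in> R d" by blast
  have "(\<Sum>e\<in>J. if x \<in> R e then c else 0) = (\<Sum>e\<in>J. if e = d then c else 0)"
    using R_disjointD d assms(2) by (intro sum.cong) auto
  then show ?thesis using d assms(1) by auto
qed auto

text \<open>Orthogonality of vertices comes from disjointness of the \<open>D v\<close>, the source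
  relations from \<open>R_subset_D\<close>, the ghost-edge products from bijectivity of
  \<open>f e\<close> and disjointness of the \<open>R e\<close>, and the Cuntz-Krieger relation from
  \<open>D_eq\<close>.\<close>

lemma eval_op_leavitt_relation:
  assumes "p \<in> leavitt_relations E"
  shows "eval_op p \<phi> x = (0::'k::field)"
  using assms
proof cases
  case (cuntz_krieger v)
  have "eval_op p \<phi> x = branching_op (Vertex v) \<phi> x
      - (\<Sum>e\<in>out_arcs E v. if x \<in> R e then \<phi> x else 0)"
    unfolding cuntz_krieger(1) eval_op_diff eval_op_sum eval_op_times eval_op_generator
    by (intro arg_cong2[of _ _ _ _ "(-)"] sum.cong refl edge_ghost_op) simp
  also have "(\<Sum>e\<in>out_arcs E v. if x \<in> R e then \<phi> x else 0) = branching_op (Vertex v) \<phi> x"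
  proof -
    have "out_arcs E v \<subseteq> arcs E" by auto
    then show ?thesis
      by (simp add: sum_over_R[OF cuntz_krieger(3)] D_eq[OF cuntz_krieger(2-4)] indicator_def)
  qed
  also have "branching_op (Vertex v) \<phi> x - \<dots> = 0" by simp
  finally show ?thesis .
next
  case (vertex_orth v w)
  then show ?thesis
    using D_disjointD[of v w x] by (auto simp: eval_op_times eval_op_generator indicator_def)
next
  case (source_edge e)
  then show ?thesis
    using R_subset_D[of e]
    by (auto simp: eval_op_diff eval_op_times eval_op_generator indicator_def)
next
  case (ghost_source e)
  then show ?thesis
    using R_subset_D[of e] f_mem[of e x]
    by (auto simp: eval_op_diff eval_op_times eval_op_generator indicator_def)
next
  case (ghost_edge_diff e d)
  then show ?thesis
    using R_disjointD[of e d "f e x"] f_mem[of e x]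
    by (auto simp: eval_op_times eval_op_generator)
qed (simp_all add: eval_op_diff eval_op_times eval_op_generator f_mem inv_f_mem inv_f_f
    indicator_def)

theorem branching_system_representation:
  "\<exists>\<pi> \<in> algebra_hom (leavitt_path_algebra E) (Hom (functions_on X :: ('x \<Rightarrow> 'k::field) set)).
    \<forall>g. \<forall>\<phi>\<in>functions_on X. \<pi> (leavitt_gen E g) \<phi> = branching_op g \<phi>"
  unfolding leavitt_path_algebra_def leavitt_gen_def leavitt_ideal_def
  by (intro quotient_algebra_representation leavitt_relations_subset wf_digraph_axioms
      eval_op_leavitt_relation branching_op_functions_on)

end

section \<open>The interval construction\<close>

text \<open>The set of positions is an initial segment of the positive integers, finite or not. This
  is what excludes gaps between the unit intervals.\<close>

lemma enumerates_downward:
  assumes "enumerates n A" "a \<in> A" "1 \<le> k" "k \<le> n a"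
  obtains b where "b \<in> A" "n b = k"
proof -
  have N: "n ` A = (if finite A then {1..card A} else {1..})"
    using assms(1) unfolding enumerates_def by (rule bij_betw_imp_surj_on)
  have "k \<in> n ` A"
  proof (cases "finite A")
    case True
    then have "n ` A = {1..card A}" using N by (simp only: if_True)
    moreover from this have "n a \<le> card A" using assms(2) by (metis atLeastAtMost_iff imageI)
    ultimately show ?thesis using assms(3,4) by (metis atLeastAtMost_iff order.trans)
  next
    case False
    then have "n ` A = {1..}" using N by (simp only: if_False)
    then show ?thesis using assms(3) by (metis atLeast_iff)
  qed
  then obtain b where "b \<in> A" "k = n b" by (rule imageE)
  then show ?thesis using that by metis
qed

text \<open>Edges fill consecutive unit cells from 0 upwards, sinks fill them from 0 downwards. For
  \<open>x \<ge> 0\<close> the cell of \<open>b\<close> forces that of \<open>x\<close> to be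
  present; for \<open>x < 0\<close> the cell of \<open>a\<close> does.\<close>

lemma (in interval_construction) X_is_interval: "is_interval X"
  unfolding is_interval_1
proof (intro ballI allI impI)
  fix a b x assume a: "a \<in> X" and b: "b \<in> X" and "a \<le> x \<and> x \<le> b"
  then have x: "a \<le> x" "x \<le> b" by auto
  show "x \<in> X"
  proof (cases "x \<ge> 0")
    case True
    then have "\<not> b < 0" using x(2) by linarith
    then obtain e where e: "e \<in> arcs E" "b \<in> R e"
      using b D_sink_neg unfolding X_eq by blast
    \<comment> \<open>The edge position whose cell \<open>{k - 1..<k}\<close> contains
      \<open>x\<close>; the shift by one reflects that positions start at 1.\<close>
    define k where "k = nat \<lfloor>x\<rfloor> + 1"
    have "real k = of_int \<lfloor>x\<rfloor> + 1" using True by (simp add: k_def)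
    then have k: "real k - 1 \<le> x" "x < real k" by linarith+
    have "real k - 1 < real (edge_no e)" using k x(2) e by (simp add: R_eq)
    then have "k \<le> edge_no e" by linarith
    moreover have "1 \<le> k" by (simp add: k_def)
    ultimately obtain d where d: "d \<in> arcs E" "edge_no d = k"
      using enumerates_downward[OF edge_no e(1), of k] by metis
    then have "x \<in> R d" using k by (simp add: R_eq)
    then show ?thesis using d(1) unfolding X_eq by blast
  next
    case False
    then have "\<not> a \<ge> 0" using x(1) by linarith
    then obtain v where v: "v \<in> sinks E" "a \<in> D v"
      using a R_nonneg unfolding X_eq by blast
    \<comment> \<open>The sink position whose cell \<open>{- k..<- k + 1}\<close> contains
      \<open>x\<close>. As \<open>x\<close> is strictly negative its floor is at most -1, so
      \<open>k\<close> is a valid position.\<close>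
    define k where "k = nat (- \<lfloor>x\<rfloor>)"
    have "\<lfloor>x\<rfloor> < 0" using False by simp
    then have "real k = - of_int \<lfloor>x\<rfloor>" "1 \<le> k" unfolding k_def by (simp, linarith)
    then have k: "- real k \<le> x" "x < - real k + 1" "1 \<le> k" by linarith+
    have "real k < real (sink_no v) + 1" using k x(1) v by (simp add: D_sink)
    then have "k \<le> sink_no v" by linarith
    then obtain w where w: "w \<in> sinks E" "sink_no w = k"
      using enumerates_downward[OF sink_no v(1) k(3)] by metis
    then have "x \<in> D w" using k by (simp add: D_sink)
    then show ?thesis using w(1) unfolding X_eq by blast
  qed
qed

theorem corollary3p2:
  fixes E :: "('v, 'e) pre_digraph"
    and edge_no :: "'e \<Rightarrow> nat" and sink_no :: "'v \<Rightarrow> nat"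
    and X :: "real set" and R :: "'e \<Rightarrow> real set" and D :: "'v \<Rightarrow> real set"
    and f :: "'e \<Rightarrow> real \<Rightarrow> real"
    and M :: "(real \<Rightarrow> 'k::field) set"
  assumes "wf_digraph E" and "countable (verts E)" and "countable (arcs E)"
    and "interval_construction E edge_no sink_no X R D f"
    and "M = functions_on X"
  shows "is_interval X \<and>
    (\<exists>\<pi> \<in> algebra_hom
        (leavitt_path_algebra E ::
          ('k, (('v, 'e) leavitt_generator, 'k) free_algebra set) nonunital_algebra)
        (Hom M).
      (\<forall>v\<in>verts E. \<forall>\<phi>\<in>M.
         \<pi> (leavitt_gen E (Vertex v)) \<phi> = (\<lambda>x. indicator (D v) x * \<phi> x))
      \<and> (\<forall>e\<in>arcs E. \<forall>\<phi>\<in>M.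
         \<pi> (leavitt_gen E (Edge e)) \<phi> =
           (\<lambda>x. if x \<in> R e then \<phi> (inv_into (D (head E e)) (f e) x) else 0))
      \<and> (\<forall>e\<in>arcs E. \<forall>\<phi>\<in>M.
         \<pi> (leavitt_gen E (Ghost e)) \<phi> =
           (\<lambda>x. if x \<in> D (head E e) then \<phi> (f e x) else 0)))"
proof -
  interpret interval_construction E edge_no sink_no X R D f by fact
  obtain \<pi> where "\<pi> \<in> algebra_hom (leavitt_path_algebra E ::
      ('k, (('v, 'e) leavitt_generator, 'k) free_algebra set) nonunital_algebra) (Hom M)"
    and "\<forall>g. \<forall>\<phi>\<in>M. \<pi> (leavitt_gen E g) \<phi> = branching_op g \<phi>"
    using branching_system_representation[where 'k = 'k] unfolding \<open>M = functions_on X\<close> by blast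
  then show ?thesis using X_is_interval by (intro conjI bexI[of _ \<pi>]) auto
qed

end
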